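(* Let $G_1$ be a simple connected $r_1$-regular graph with $n_1$ vertices and $m_1$ edges, and let $G_2$ be a simple connected graph with $n_2$ vertices and $m_2$ edges, with signless Laplacians $Q_1,Q_2$. Let $G=G_1\diamond G_2$ be their edge corona, with signless Laplacian $Q$. Then, as an identity of rational functions in $\lambda$, \[ f_Q (\lambda ) = (f_{Q_2 } (\lambda -2))^{m_1 } f_{Q_1 } \left(( - 1)^{n_2}\frac{(\lambda -r_1 n_2)\, f_{Q_2} (\lambda-2 )}{ f_{\overline{Q_2} } ( n_2 - \lambda )} \right)\left( ( - 1)^{n_2} \frac{f_{\overline{Q_2} } \left( n_2 - \lambda \right)}{f_{Q_2} (\lambda-2 )}\right)^{n_1}. \]
   Context: For a simple graph $H$ on $m$ vertices, $Q(H)=D(H)+A(H)$ is its signless Laplacian (degree diagonal matrix plus adjacency matrix). $f_Q(\lambda)=\det(\lambda I-Q)$ for $Q=Q(G)$, $f_{Q_i}(\lambda)=\det(\lambda I_{n_i}-Q_i)$, and $f_{\overline{Q_2}}(\lambda)=\det(\lambda I_{n_2}-Q(\overline{G_2}))$ where $\overline{G_2}$ is the complement of $G_2$. The edge corona $G_1\diamond G_2$ is obtained by taking one copy of $G_1$ and $m_1$ disjoint copies of $G_2$, and, for each $i=1,\dots,m_1$, joining both end-vertices of the $i$-th edge of $G_1$ by edges to every vertex of the $i$-th copy of $G_2$. *)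

theory Defs
  imports
    "HOL-Computational_Algebra.Polynomial_Factorial"
    "Jordan_Normal_Form.Char_Poly"
    "Graph_Theory.Digraph_Component"
begin

text \<open>
  Finite simple graphs are the locale \<open>pair_graph\<close>: an undirected edge between \<open>u\<close> and \<open>v\<close> is
  the pair of opposite arcs \<open>(u, v)\<close> and \<open>(v, u)\<close>. Hence the degree of a vertex is its
  \<open>out_degree\<close>, while edges have to be counted as two-element sets.
\<close>

definition undirected_edges :: "'a pair_pre_digraph \<Rightarrow> 'a set set" where
  "undirected_edges G = {{u, v} | u v. (u, v) \<in> parcs G}"

definition regular :: "'a pair_pre_digraph \<Rightarrow> nat \<Rightarrow> bool" where
  "regular G r \<longleftrightarrow> (\<forall>v\<in>pverts G. out_degree (with_proj G) v = r)"

definition graph_complement :: "'a pair_pre_digraph \<Rightarrow> 'a pair_pre_digraph" where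
  "graph_complement G =
    \<lparr> pverts = pverts G,
      parcs = {(u, v). u \<in> pverts G \<and> v \<in> pverts G \<and> u \<noteq> v \<and> (u, v) \<notin> parcs G} \<rparr>"

text \<open>
  The copies of the second graph are indexed by the edges of the first one:
  \<open>Inr (e, x)\<close> is the vertex \<open>x\<close> in the copy belonging to the edge \<open>e\<close>.
\<close>

definition edge_corona ::
    "'a pair_pre_digraph \<Rightarrow> 'b pair_pre_digraph \<Rightarrow> ('a + 'a set \<times> 'b) pair_pre_digraph" where
  "edge_corona G1 G2 =
    \<lparr> pverts = Inl ` pverts G1 \<union> Inr ` (undirected_edges G1 \<times> pverts G2),
      parcs =
        {(Inl u, Inl v) | u v. (u, v) \<in> parcs G1} \<union>
        {(Inr (e, x), Inr (e, y)) | e x y. e \<in> undirected_edges G1 \<and> (x, y) \<in> parcs G2} \<union>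
        {(Inl u, Inr (e, x)) | u e x. e \<in> undirected_edges G1 \<and> u \<in> e \<and> x \<in> pverts G2} \<union>
        {(Inr (e, x), Inl u) | u e x. e \<in> undirected_edges G1 \<and> u \<in> e \<and> x \<in> pverts G2} \<rparr>"

lemma pair_graph_iff:
  "pair_graph G \<longleftrightarrow> finite (pverts G) \<and> parcs G \<subseteq> pverts G \<times> pverts G \<and>
    (\<forall>u v. (u, v) \<in> parcs G \<longrightarrow> u \<noteq> v \<and> (v, u) \<in> parcs G)"
proof
  assume "pair_graph G"
  then interpret pair_graph G .
  have "u \<noteq> v" if "(u, v) \<in> parcs G" for u v
    using pair_no_loops[OF that] by simp
  moreover have "(v, u) \<in> parcs G" if "(u, v) \<in> parcs G" for u v
    using that by (rule arcs_symmetric)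
  moreover have "parcs G \<subseteq> pverts G \<times> pverts G"
    using in_arcsD1 in_arcsD2 by auto
  ultimately show "finite (pverts G) \<and> parcs G \<subseteq> pverts G \<times> pverts G \<and>
      (\<forall>u v. (u, v) \<in> parcs G \<longrightarrow> u \<noteq> v \<and> (v, u) \<in> parcs G)"
    using pair_finite_verts by blast
next
  assume G: "finite (pverts G) \<and> parcs G \<subseteq> pverts G \<times> pverts G \<and>
    (\<forall>u v. (u, v) \<in> parcs G \<longrightarrow> u \<noteq> v \<and> (v, u) \<in> parcs G)"
  then have "finite (parcs G)"
    by (meson finite_SigmaI finite_subset)
  moreover have "sym (parcs G)"
    using G by (auto intro: symI)
  ultimately show "pair_graph G"
    using G by unfold_locales (auto simp: symmetric_def)
qed

lemma pair_graph_graph_complement: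
  "pair_graph G \<Longrightarrow> pair_graph (graph_complement G)"
  by (auto simp: pair_graph_iff graph_complement_def)

lemma pair_graph_edge_corona:
  assumes "pair_graph G1" and "pair_graph G2"
  shows "pair_graph (edge_corona G1 G2)"
proof -
  have sub: "undirected_edges G1 \<subseteq> Pow (pverts G1)"
    using assms(1) unfolding pair_graph_iff undirected_edges_def by blast
  have "finite (undirected_edges G1)"
    using sub assms(1) by (meson finite_Pow_iff finite_subset pair_graph_iff)
  then have "finite (pverts (edge_corona G1 G2))"
    using assms by (simp add: edge_corona_def pair_graph_iff)
  moreover have "parcs (edge_corona G1 G2) \<subseteq>
      pverts (edge_corona G1 G2) \<times> pverts (edge_corona G1 G2)"
    using sub assms unfolding pair_graph_iff edge_corona_def by auto
  moreover have "u \<noteq> v \<and> (v, u) \<in> parcs (edge_corona G1 G2)"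
    if "(u, v) \<in> parcs (edge_corona G1 G2)" for u v
    using that assms unfolding pair_graph_iff edge_corona_def by auto
  ultimately show ?thesis
    unfolding pair_graph_iff by blast
qed

text \<open>
  Rows and columns of the matrices are indexed by positions in a list \<open>vs\<close>, which is meant to
  enumerate the vertices without repetition.
\<close>

definition vertex_enumeration :: "'a pair_pre_digraph \<Rightarrow> 'a list \<Rightarrow> bool" where
  "vertex_enumeration G vs \<longleftrightarrow> distinct vs \<and> set vs = pverts G"

definition degree_matrix :: "'a pair_pre_digraph \<Rightarrow> 'a list \<Rightarrow> real mat" where
  "degree_matrix G vs = mat (length vs) (length vs)
    (\<lambda>(i, j). if i = j then real (out_degree (with_proj G) (vs ! i)) else 0)"

definition adjacency_matrix :: "'a pair_pre_digraph \<Rightarrow> 'a list \<Rightarrow> real mat" where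
  "adjacency_matrix G vs = mat (length vs) (length vs)
    (\<lambda>(i, j). if (vs ! i, vs ! j) \<in> parcs G then 1 else 0)"

definition signless_laplacian :: "'a pair_pre_digraph \<Rightarrow> 'a list \<Rightarrow> real mat" where
  "signless_laplacian G vs = degree_matrix G vs + adjacency_matrix G vs"

text \<open>
  The field of rational functions over the reals is \<open>real poly fract\<close>. A real polynomial can be
  evaluated at a rational function after its coefficients are embedded as constants.
\<close>

type_synonym ratfun = "real poly fract"

definition ratfun_var :: ratfun where
  "ratfun_var = to_fract [:0, 1:]"

definition poly_at_ratfun :: "real poly \<Rightarrow> ratfun \<Rightarrow> ratfun" where
  "poly_at_ratfun p x = poly (map_poly (\<lambda>c. to_fract [:c:]) p) x"

definition signless_char_fun :: "'a pair_pre_digraph \<Rightarrow> 'a list \<Rightarrow> ratfun \<Rightarrow> ratfun" where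
  "signless_char_fun G vs x = poly_at_ratfun (char_poly (signless_laplacian G vs)) x"

lemma poly_at_ratfun_var: "poly_at_ratfun p ratfun_var = to_fract p"
proof (induction p)
  case 0
  then show ?case by (simp add: poly_at_ratfun_def)
next
  case (pCons a p)
  have "pCons a p = [:a:] + [:0, 1:] * p"
    by simp
  then have "to_fract (pCons a p) = to_fract [:a:] + to_fract [:0, 1:] * to_fract p"
    by (simp only: to_fract_add to_fract_mult)
  with pCons show ?case
    by (simp add: poly_at_ratfun_def ratfun_var_def map_poly_pCons)
qed

end

theory Submission
  imports Defs
begin

text \<open>
  List the copies of \<open>G\<^sub>2\<close> before \<open>G\<^sub>1\<close>. Each copy contributes the diagonal block
  \<open>M = (\<lambda> - 2) I - Q\<^sub>2\<close>, and eliminating the copy at an edge \<open>e\<close> subtracts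
  \<open>\<chi> r\<^sub>e r\<^sub>e\<^sup>T\<close> from the block of \<open>G\<^sub>1\<close>, where \<open>r\<^sub>e\<close> is the incidence vector of \<open>e\<close> and
  \<open>\<chi> = 1\<^sup>T M\<^sup>-\<^sup>1 1\<close>. The sum of all \<open>r\<^sub>e r\<^sub>e\<^sup>T\<close> is \<open>Q\<^sub>1\<close>, so what remains is
  \<open>(\<lambda> - r\<^sub>1 n\<^sub>2) I - (1 + \<chi>) Q\<^sub>1\<close>. By the matrix determinant lemma
  \<open>1 + \<chi> = det (M + J) / det M\<close> with the all-ones matrix \<open>J\<close>, and
  \<open>Q\<^sub>2 + Q(complement of G\<^sub>2) = (n\<^sub>2 - 2) I + J\<close> identifies \<open>M + J\<close> with
  \<open>-((n\<^sub>2 - \<lambda>) I - Q(complement of G\<^sub>2))\<close>.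
\<close>

section \<open>Determinants of matrices indexed by lists\<close>

text \<open>Entries depend on labels instead of positions, so a block decomposition is a list
  append, and a reordering of the labels acts on rows and columns at once.\<close>

definition indexed_mat :: "('i \<Rightarrow> 'i \<Rightarrow> 'k) \<Rightarrow> 'i list \<Rightarrow> 'k mat" where
  "indexed_mat f vs = mat (length vs) (length vs) (\<lambda>(i, j). f (vs ! i) (vs ! j))"

lemma indexed_mat_carrier [simp]: "indexed_mat f vs \<in> carrier_mat (length vs) (length vs)"
  by (simp add: indexed_mat_def)

lemma indexed_mat_cong:
  "(\<And>u v. u \<in> set vs \<Longrightarrow> v \<in> set vs \<Longrightarrow> f u v = g u v) \<Longrightarrow> indexed_mat f vs = indexed_mat g vs"
  by (auto simp: indexed_mat_def)

lemma indexed_mat_map: "indexed_mat f (map h vs) = indexed_mat (\<lambda>i j. f (h i) (h j)) vs"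
  by (auto simp: indexed_mat_def)

lemma det_indexed_mat_smult:
  fixes f :: "'i \<Rightarrow> 'i \<Rightarrow> 'k::comm_ring_1"
  shows "det (indexed_mat (\<lambda>i j. c * f i j) vs) = c ^ length vs * det (indexed_mat f vs)"
proof -
  have "indexed_mat (\<lambda>i j. c * f i j) vs = c \<cdot>\<^sub>m indexed_mat f vs"
    by (auto simp: indexed_mat_def)
  then show ?thesis
    by (simp add: indexed_mat_def)
qed

text \<open>Rows and columns undergo the same permutation, so its sign occurs twice and squares to
  1.\<close>

lemma det_indexed_mat_reorder:
  fixes f :: "'i \<Rightarrow> 'i \<Rightarrow> 'k::comm_ring_1"
  assumes "mset vs = mset ws"
  shows "det (indexed_mat f vs) = det (indexed_mat f ws)"
proof -
  define n where "n = length ws"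
  have len: "length vs = n"
    using assms by (metis n_def size_mset)
  obtain p where p: "p permutes {..<length ws}" "permute_list p ws = vs"
    using assms by (rule mset_eq_permutation)
  then have pn: "p permutes {0..<n}"
    by (simp add: n_def atLeast0LessThan)
  have nth: "vs ! i = ws ! p i" if "i < n" for i
    using p that by (metis n_def permute_list_nth)
  have pl: "p i < n" if "i < n" for i
    using permutes_in_image[OF pn, of i] that by simp
  define B where "B = mat n n (\<lambda>(i, j). f (ws ! i) (vs ! j))"
  have B: "B \<in> carrier_mat n n" and W: "indexed_mat f ws \<in> carrier_mat n n"
    by (simp_all add: B_def n_def)
  have "indexed_mat f vs = mat n n (\<lambda>(i, j). B $$ (p i, j))"
    using pl by (auto simp: indexed_mat_def len B_def nth)
  then have 1: "det (indexed_mat f vs) = signof p * det B"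
    using det_permute_rows[OF B pn] by simp
  have "B\<^sup>T = mat n n (\<lambda>(i, j). (indexed_mat f ws)\<^sup>T $$ (p i, j))"
    using pl by (auto simp: indexed_mat_def len B_def nth n_def)
  then have "det B = signof p * det (indexed_mat f ws)"
    using det_permute_rows[of "(indexed_mat f ws)\<^sup>T" n p] pn W
    by (metis B det_transpose transpose_carrier_mat)
  with 1 have "det (indexed_mat f vs) = (signof p * signof p) * det (indexed_mat f ws)"
    by simp
  also have "(signof p * signof p :: 'k) = 1"
    by (simp add: sign_def)
  finally show ?thesis
    by simp
qed

lemma sum_nth_distinct:
  assumes "distinct us"
  shows "(\<Sum>i<length us. g (us ! i)) = sum g (set us)"
  using sum.reindex_bij_betw[OF bij_betw_nth[OF assms refl refl], of g] .

text \<open>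
  Schur complement, with \<open>X\<close> in the role of the product of the inverse of the leading block
  and the upper right block.
\<close>

lemma det_indexed_mat_append:
  fixes f :: "'i \<Rightarrow> 'i \<Rightarrow> 'k::idom"
  assumes "distinct us"
    and X: "\<And>i j. i \<in> set us \<Longrightarrow> j \<in> set ws \<Longrightarrow> (\<Sum>k\<in>set us. f i k * X k j) = f i j"
  shows "det (indexed_mat f (us @ ws)) = det (indexed_mat f us) *
    det (indexed_mat (\<lambda>i j. f i j - (\<Sum>k\<in>set us. f i k * X k j)) ws)"
proof -
  define n m where "n = length us" and "m = length ws"
  let ?P = "indexed_mat f us" and ?S = "indexed_mat f ws"
  let ?Q = "mat n m (\<lambda>(i, j). f (us ! i) (ws ! j))" and ?R = "mat m n (\<lambda>(i, j). f (ws ! i) (us ! j))"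
  let ?X = "mat n m (\<lambda>(i, j). X (us ! i) (ws ! j))"
  let ?T = "indexed_mat (\<lambda>i j. f i j - (\<Sum>k\<in>set us. f i k * X k j)) ws"
  have P: "?P \<in> carrier_mat n n" and S: "?S \<in> carrier_mat m m"
    and T: "?T \<in> carrier_mat m m"
    by (auto simp: n_def m_def)
  have block: "indexed_mat f (us @ ws) = four_block_mat ?P ?Q ?R ?S"
    by (auto simp: indexed_mat_def n_def m_def nth_append not_less)
  have PX: "?P * (- ?X) + ?Q * 1\<^sub>m m = 0\<^sub>m n m"
  proof (rule eq_matI)
    fix i j assume ij: "i < dim_row (0\<^sub>m n m :: 'k mat)" "j < dim_col (0\<^sub>m n m :: 'k mat)"
    have "(\<Sum>k<n. f (us ! i) (us ! k) * X (us ! k) (ws ! j)) = f (us ! i) (ws ! j)"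
      using ij X[of "us ! i" "ws ! j"] sum_nth_distinct[OF assms(1), of "\<lambda>k. f (us ! i) k * X k (ws ! j)"]
      by (simp add: n_def m_def)
    with ij show "(?P * (- ?X) + ?Q * 1\<^sub>m m) $$ (i, j) = 0\<^sub>m n m $$ (i, j)"
      by (simp add: indexed_mat_def n_def m_def scalar_prod_def sum_negf atLeast0LessThan)
  qed (auto simp: indexed_mat_def n_def m_def)
  have RX: "?R * (- ?X) + ?S * 1\<^sub>m m = ?T"
  proof (rule eq_matI)
    fix i j assume ij: "i < dim_row ?T" "j < dim_col ?T"
    have "(\<Sum>k<n. f (ws ! i) (us ! k) * X (us ! k) (ws ! j)) = (\<Sum>k\<in>set us. f (ws ! i) k * X k (ws ! j))"
      using sum_nth_distinct[OF assms(1), of "\<lambda>k. f (ws ! i) k * X k (ws ! j)"]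
      by (simp add: n_def)
    with ij show "(?R * (- ?X) + ?S * 1\<^sub>m m) $$ (i, j) = ?T $$ (i, j)"
      by (simp add: indexed_mat_def n_def m_def scalar_prod_def sum_negf atLeast0LessThan)
  qed (auto simp: indexed_mat_def n_def m_def)
  \<comment> \<open>Right multiplication by this unipotent matrix clears the upper right block and
    puts the Schur complement in the lower right one, without forming an inverse of
    \<open>?P\<close>.\<close>
  let ?E = "four_block_mat (1\<^sub>m n) (- ?X) (0\<^sub>m m n) (1\<^sub>m m)"
  have "indexed_mat f (us @ ws) * ?E =
      four_block_mat (?P * 1\<^sub>m n + ?Q * 0\<^sub>m m n) (?P * (- ?X) + ?Q * 1\<^sub>m m)
        (?R * 1\<^sub>m n + ?S * 0\<^sub>m m n) (?R * (- ?X) + ?S * 1\<^sub>m m)"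
    unfolding block by (rule mult_four_block_mat) (use P S in auto)
  also have "?P * 1\<^sub>m n + ?Q * 0\<^sub>m m n = ?P"
    using P by auto
  also have "?R * 1\<^sub>m n + ?S * 0\<^sub>m m n = ?R"
    using S by auto
  finally have "indexed_mat f (us @ ws) * ?E = four_block_mat ?P (0\<^sub>m n m) ?R ?T"
    unfolding PX RX .
  moreover have "det (four_block_mat ?P (0\<^sub>m n m) ?R ?T) = det ?P * det ?T"
    by (rule det_four_block_mat_upper_right_zero[OF P refl _ T]) simp
  moreover have "det ?E = 1"
    by (subst det_four_block_mat_lower_left_zero[of _ n _ m]) auto
  moreover have "det (indexed_mat f (us @ ws) * ?E) = det (indexed_mat f (us @ ws)) * det ?E"
    by (rule det_mult[of _ "n + m"]) (auto simp: block n_def m_def)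
  ultimately show ?thesis
    by simp
qed

text \<open>Cramer's rule: the adjugate, divided by the determinant, is applied to the right-hand
  side.\<close>

lemma indexed_mat_solve:
  fixes f :: "'i \<Rightarrow> 'i \<Rightarrow> 'k::field"
  assumes "distinct us" and nz: "det (indexed_mat f us) \<noteq> 0"
  obtains u where "\<And>i. i \<in> set us \<Longrightarrow> (\<Sum>k\<in>set us. f i k * u k) = b i"
proof -
  define n where "n = length us"
  let ?A = "indexed_mat f us"
  have A: "?A \<in> carrier_mat n n"
    by (simp add: n_def)
  define bv where "bv = vec n (\<lambda>i. b (us ! i))"
  have bv: "bv \<in> carrier_vec n"
    by (simp add: bv_def)
  define v where "v = inverse (det ?A) \<cdot>\<^sub>v (adj_mat ?A *\<^sub>v bv)"
  have v: "v \<in> carrier_vec n"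
    using adj_mat(1)[OF A] bv by (auto simp: v_def)
  have "?A *\<^sub>v v = inverse (det ?A) \<cdot>\<^sub>v ((?A * adj_mat ?A) *\<^sub>v bv)"
    unfolding v_def using A adj_mat(1)[OF A] bv
    by (simp add: mult_mat_vec assoc_mult_mat_vec[of _ n n _ n])
  also have "\<dots> = bv"
    using nz bv unfolding adj_mat(2)[OF A]
    by (auto simp: smult_smult_assoc)
  finally have Av: "?A *\<^sub>v v = bv" .
  define u where "u x = v $ the_inv_into {..<n} ((!) us) x" for x
  have bij: "bij_betw ((!) us) {..<n} (set us)"
    using bij_betw_nth assms(1) n_def by blast
  have u: "u (us ! k) = v $ k" if "k < n" for k
    using bij that by (simp add: u_def bij_betw_def the_inv_into_f_f)
  show ?thesis
  proof (rule that)
    fix i assume "i \<in> set us"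
    then obtain l where l: "l < n" "i = us ! l"
      by (metis in_set_conv_nth n_def)
    have "(\<Sum>k\<in>set us. f i k * u k) = (\<Sum>k<n. f (us ! l) (us ! k) * v $ k)"
      using sum_nth_distinct[OF assms(1), of "\<lambda>k. f i k * u k"] l by (simp add: n_def u)
    also have "\<dots> = (?A *\<^sub>v v) $ l"
      using l v by (simp add: indexed_mat_def n_def scalar_prod_def atLeast0LessThan)
    also have "\<dots> = b i"
      using l by (simp add: Av bv_def)
    finally show "(\<Sum>k\<in>set us. f i k * u k) = b i" .
  qed
qed

lemma det_indexed_mat_add_one:
  fixes f :: "'i \<Rightarrow> 'i \<Rightarrow> 'k::idom"
  assumes "distinct us" and u: "\<And>i. i \<in> set us \<Longrightarrow> (\<Sum>k\<in>set us. f i k * u k) = 1"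
  shows "det (indexed_mat (\<lambda>i j. f i j + 1) us) = det (indexed_mat f us) * (1 + sum u (set us))"
proof -
  \<comment> \<open>Border \<open>f\<close> by a column of ones and a row of minus ones, and eliminate the two diagonal
      blocks in either order.\<close>
  define g :: "'i option \<Rightarrow> 'i option \<Rightarrow> 'k" where
    "g i j = (case i of None \<Rightarrow> (case j of None \<Rightarrow> 1 | Some _ \<Rightarrow> -1)
       | Some x \<Rightarrow> (case j of None \<Rightarrow> 1 | Some y \<Rightarrow> f x y))" for i j
  have sing: "det (indexed_mat h [i]) = h i i" for h :: "'i option \<Rightarrow> 'i option \<Rightarrow> 'k" and i
    by (subst det_single) (auto simp: indexed_mat_def)
  \<comment> \<open>Eliminating \<open>f\<close> first leaves the corner 1 minus the product of the
    row of minus ones with \<open>u\<close>.\<close>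
  have "det (indexed_mat g (map Some us @ [None])) = det (indexed_mat f us) * (1 + sum u (set us))"
    by (subst det_indexed_mat_append[where X = "\<lambda>i j. u (the i)"])
      (use assms in \<open>auto simp: distinct_map g_def sing indexed_mat_map sum.reindex sum_negf\<close>)
  \<comment> \<open>With the corner 1 as pivot, \<open>X\<close> is the row of minus ones itself,
    and the Schur complement is \<open>f i j + 1\<close>.\<close>
  moreover have "det (indexed_mat g ([None] @ map Some us)) = det (indexed_mat (\<lambda>i j. f i j + 1) us)"
    by (subst det_indexed_mat_append[where X = "\<lambda>i j. -1"])
      (auto simp: g_def sing indexed_mat_map)
  moreover have "det (indexed_mat g (map Some us @ [None])) = det (indexed_mat g ([None] @ map Some us))"
    by (rule det_indexed_mat_reorder) simp
  ultimately show ?thesis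
    by simp
qed

section \<open>Matrices with copies of a block attached\<close>

text \<open>\<open>r a e\<close> is the entry between \<open>a\<close> and every vertex of the copy of \<open>M\<close> attached to \<open>e\<close>.\<close>

definition attached_copies ::
    "('a \<Rightarrow> 'a \<Rightarrow> 'k) \<Rightarrow> ('b \<Rightarrow> 'b \<Rightarrow> 'k) \<Rightarrow> ('a \<Rightarrow> 'e \<Rightarrow> 'k) \<Rightarrow> 'a + 'e \<times> 'b \<Rightarrow> 'a + 'e \<times> 'b \<Rightarrow> 'k::zero" where
  "attached_copies A M r i j = (case i of
      Inl a \<Rightarrow> (case j of Inl b \<Rightarrow> A a b | Inr (e, y) \<Rightarrow> r a e)
    | Inr (d, x) \<Rightarrow> (case j of Inl b \<Rightarrow> r b d | Inr (e, y) \<Rightarrow> if d = e then M x y else 0))"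

text \<open>The blocks between different copies are zero, so eliminating one copy changes only the
  base block, by a multiple of an outer product. What remains is again of the form
  \<open>attached_copies\<close>, which is why \<open>A\<close> varies in the induction.\<close>

lemma det_attached_copies:
  fixes A :: "'a \<Rightarrow> 'a \<Rightarrow> 'k::idom" and M :: "'b \<Rightarrow> 'b \<Rightarrow> 'k" and r :: "'a \<Rightarrow> 'e \<Rightarrow> 'k"
  assumes us: "distinct us" and u: "\<And>x. x \<in> set us \<Longrightarrow> (\<Sum>y\<in>set us. M x y * u y) = 1"
    and "distinct es"
  shows "det (indexed_mat (attached_copies A M r)
      (concat (map (\<lambda>e. map (\<lambda>x. Inr (e, x)) us) es) @ map Inl ws)) =
    det (indexed_mat M us) ^ length es *
    det (indexed_mat (\<lambda>a b. A a b - sum u (set us) * (\<Sum>e\<in>set es. r a e * r b e)) ws)"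
  using \<open>distinct es\<close>
proof (induction es arbitrary: A)
  case Nil
  then show ?case
    by (simp add: indexed_mat_map attached_copies_def)
next
  case (Cons e es)
  let ?F = "attached_copies A M r"
  let ?copy = "map (\<lambda>x. Inr (e, x) :: 'a + 'e \<times> 'b) us"
  let ?rest = "concat (map (\<lambda>e. map (\<lambda>x. Inr (e, x) :: 'a + 'e \<times> 'b) us) es) @ map Inl ws"
  \<comment> \<open>Since \<open>M\<close> maps \<open>u\<close> to the ones vector, the column of a
    base vertex \<open>b\<close> is solved by \<open>u\<close> scaled with \<open>r b e\<close>; the
    columns of other copies vanish on this copy.\<close>
  let ?X = "\<lambda>(i :: 'a + 'e \<times> 'b) (j :: 'a + 'e \<times> 'b). case i of Inl _ \<Rightarrow> 0 | Inr (d, x) \<Rightarrow> (case j of Inl b \<Rightarrow> u x * r b e | Inr _ \<Rightarrow> 0)"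
  let ?A' = "\<lambda>a b. A a b - sum u (set us) * (r a e * r b e)"
  have sum_copy: "(\<Sum>k\<in>set ?copy. h k) = (\<Sum>x\<in>set us. h (Inr (e, x)))" for h :: "'a + _ \<times> _ \<Rightarrow> 'k"
    by (simp add: sum.reindex inj_on_def)
  have "det (indexed_mat ?F (?copy @ ?rest)) = det (indexed_mat ?F ?copy) *
      det (indexed_mat (\<lambda>i j. ?F i j - (\<Sum>k\<in>set ?copy. ?F i k * ?X k j)) ?rest)"
  proof (rule det_indexed_mat_append)
    show "distinct ?copy"
      using us by (simp add: distinct_map inj_on_def)
    fix i j assume "i \<in> set ?copy" and j: "j \<in> set ?rest"
    then obtain x where x: "i = Inr (e, x)" "x \<in> set us"
      by auto
    show "(\<Sum>k\<in>set ?copy. ?F i k * ?X k j) = ?F i j"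
    proof (cases j)
      case (Inl b)
      then show ?thesis
        using x u[OF x(2)] unfolding sum_copy
        by (simp add: attached_copies_def flip: mult.assoc sum_distrib_right)
    next
      case (Inr p)
      with j Cons.prems have "fst p \<noteq> e"
        by auto
      with Inr x show ?thesis
        unfolding sum_copy by (auto simp: attached_copies_def split: prod.split)
    qed
  qed
  also have "indexed_mat ?F ?copy = indexed_mat M us"
    by (simp add: indexed_mat_map attached_copies_def)
  also have "indexed_mat (\<lambda>i j. ?F i j - (\<Sum>k\<in>set ?copy. ?F i k * ?X k j)) ?rest =
      indexed_mat (attached_copies ?A' M r) ?rest"
    unfolding sum_copy
    by (rule indexed_mat_cong)
      (use Cons.prems in \<open>auto simp: attached_copies_def sum_distrib_left sum_distrib_right mult_ac
        intro!: sum.neutral\<close>)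
  also have "det \<dots> = det (indexed_mat M us) ^ length es *
      det (indexed_mat (\<lambda>a b. ?A' a b - sum u (set us) * (\<Sum>e\<in>set es. r a e * r b e)) ws)"
    by (rule Cons.IH) (use Cons.prems in simp)
  also have "(\<lambda>a b. ?A' a b - sum u (set us) * (\<Sum>e\<in>set es. r a e * r b e)) =
      (\<lambda>a b. A a b - sum u (set us) * (\<Sum>e\<in>set (e # es). r a e * r b e))"
    using Cons.prems by (simp add: fun_eq_iff algebra_simps)
  finally show ?case
    by (simp add: mult.assoc)
qed

section \<open>Evaluation of characteristic polynomials at rational functions\<close>

lemma comm_ring_hom_const_ratfun: "comm_ring_hom (\<lambda>c::real. to_fract [:c:])"
  by unfold_locales (simp_all flip: to_fract_add to_fract_mult one_pCons)

lemma comm_ring_hom_poly_at_ratfun: "comm_ring_hom (\<lambda>p. poly_at_ratfun p x)"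
proof -
  interpret map_poly_comm_ring_hom "\<lambda>c::real. to_fract [:c:]"
    using comm_ring_hom_const_ratfun by (simp add: map_poly_comm_ring_hom_def)
  show ?thesis
    by unfold_locales (simp_all add: poly_at_ratfun_def hom_distribs)
qed

lemma poly_at_ratfun_to_fract: "poly_at_ratfun p (to_fract q) = to_fract (pcompose p q)"
proof (induction p)
  case (pCons a p)
  then show ?case
    by (cases "a = 0 \<and> p = 0")
      (auto simp: poly_at_ratfun_def map_poly_pCons pcompose_pCons)
qed (simp add: poly_at_ratfun_def)

text \<open>At a polynomial argument evaluation is composition, and composition with a nonconstant
  polynomial sends no nonzero polynomial to 0.\<close>

lemma poly_at_ratfun_nonzero:
  assumes "p \<noteq> 0" "degree q > 0"
  shows "poly_at_ratfun p (to_fract q) \<noteq> 0"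
  using assms by (simp add: poly_at_ratfun_to_fract pcompose_eq_0_iff)

text \<open>
  The entries of \<open>x I - Q(G)\<close>. Their ring is arbitrary, so that \<open>x\<close> can be a rational function.
\<close>

definition signless_entry :: "'a pair_pre_digraph \<Rightarrow> 'k::comm_ring_1 \<Rightarrow> 'a \<Rightarrow> 'a \<Rightarrow> 'k" where
  "signless_entry G x u v = (if u = v then x - of_nat (out_degree (with_proj G) u) else 0) -
    (if (u, v) \<in> parcs G then 1 else 0)"

lemma signless_laplacian_carrier [simp]:
  "signless_laplacian G vs \<in> carrier_mat (length vs) (length vs)"
  by (simp add: signless_laplacian_def degree_matrix_def adjacency_matrix_def)

text \<open>Evaluation at \<open>x\<close> is a ring homomorphism and so commutes with the
  determinant. Every factor of the formula, including the one at a rational argument, thus becomes a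
  determinant over one field.\<close>

lemma signless_char_fun_eq_det:
  assumes "distinct vs"
  shows "signless_char_fun G vs x = det (indexed_mat (signless_entry G x) vs)"
proof -
  interpret const: comm_ring_hom "\<lambda>c::real. to_fract [:c:]"
    by (rule comm_ring_hom_const_ratfun)
  interpret comm_ring_hom "\<lambda>p. poly_at_ratfun p x"
    by (rule comm_ring_hom_poly_at_ratfun)
  have "poly_at_ratfun [:a:] x = to_fract [:a:]" for a
    by (cases "a = 0"; simp add: poly_at_ratfun_def map_poly_pCons)
  moreover have "poly_at_ratfun [:a, 1:] x = to_fract [:a:] + x" for a
    by (simp add: poly_at_ratfun_def map_poly_pCons)
  ultimately have "map_mat (\<lambda>p. poly_at_ratfun p x) (char_poly_matrix (signless_laplacian G vs)) =
      indexed_mat (signless_entry G x) vs"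
    using assms
    by (auto intro!: eq_matI simp: char_poly_matrix_def signless_laplacian_def degree_matrix_def
      adjacency_matrix_def indexed_mat_def signless_entry_def nth_eq_iff_index_eq
      const.hom_minus const.hom_uminus const.hom_of_nat one_pCons)
  then show ?thesis
    unfolding signless_char_fun_def char_poly_def by (metis hom_det)
qed

text \<open>A characteristic polynomial is monic, hence nonzero. This justifies the divisions by
  values of \<open>fQ2\<close> and \<open>fQ2c\<close>.\<close>

lemma signless_char_fun_nonzero:
  assumes "degree q > 0"
  shows "signless_char_fun G vs (to_fract q) \<noteq> 0"
proof -
  have "char_poly (signless_laplacian G vs) \<noteq> 0"
    using degree_monic_char_poly[OF signless_laplacian_carrier[of G vs]] by auto
  then show ?thesis
    unfolding signless_char_fun_def using assms by (rule poly_at_ratfun_nonzero)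
qed

section \<open>Degrees and incidences in the graphs\<close>

lemma out_degree_with_proj:
  "out_degree (with_proj G) v = card {w. (v, w) \<in> parcs G}"
proof -
  have "out_arcs (with_proj G) v = Pair v ` {w. (v, w) \<in> parcs G}"
    by (auto simp: out_arcs_def)
  then show ?thesis
    by (simp add: out_degree_def card_image inj_on_def)
qed

lemma finite_undirected_edges:
  assumes "pair_graph G"
  shows "finite (undirected_edges G)"
proof -
  have "undirected_edges G \<subseteq> Pow (pverts G)"
    using assms unfolding pair_graph_iff undirected_edges_def by blast
  then show ?thesis
    using assms by (meson finite_Pow_iff finite_subset pair_graph_iff)
qed

text \<open>Entrywise, the incidence matrix times its transpose is the signless Laplacian: edges at
  \<open>u\<close> correspond to neighbours of \<open>u\<close>, and only \<open>{u, v}\<close> can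
  contain two distinct vertices \<open>u\<close> and \<open>v\<close>.\<close>

lemma card_incident_edges:
  assumes "pair_graph G"
  shows "card {e \<in> undirected_edges G. u \<in> e \<and> v \<in> e} =
    (if u = v then out_degree (with_proj G) u else if (u, v) \<in> parcs G then 1 else 0)"
proof (cases "u = v")
  case True
  have "{e \<in> undirected_edges G. u \<in> e} = (\<lambda>w. {u, w}) ` {w. (u, w) \<in> parcs G}"
    using assms by (auto simp: undirected_edges_def pair_graph_iff)
  moreover have "inj_on (\<lambda>w. {u, w}) {w. (u, w) \<in> parcs G}"
    by (auto simp: inj_on_def doubleton_eq_iff)
  ultimately show ?thesis
    using True by (simp add: out_degree_with_proj card_image)
next
  case False
  then have "{e \<in> undirected_edges G. u \<in> e \<and> v \<in> e} = (if (u, v) \<in> parcs G then {{u, v}} else {})"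
    using assms by (auto simp: undirected_edges_def pair_graph_iff)
  with False show ?thesis
    by simp
qed

lemma out_degree_edge_corona_Inl:
  assumes "pair_graph G1" "pair_graph G2"
  shows "out_degree (with_proj (edge_corona G1 G2)) (Inl u) =
    out_degree (with_proj G1) u * (1 + card (pverts G2))"
proof -
  let ?E = "{e \<in> undirected_edges G1. u \<in> e}"
  have "{w. (Inl u, w) \<in> parcs (edge_corona G1 G2)} =
      Inl ` {w. (u, w) \<in> parcs G1} \<union> Inr ` (?E \<times> pverts G2)"
    by (auto simp: edge_corona_def)
  moreover have "finite {w. (u, w) \<in> parcs G1}" and "finite (pverts G2)"
    using assms finite_subset[of "{w. (u, w) \<in> parcs G1}" "pverts G1"] by (auto simp: pair_graph_iff)
  moreover have "card (Inl ` {w. (u, w) \<in> parcs G1} \<union> Inr ` (?E \<times> pverts G2)) =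
      card {w. (u, w) \<in> parcs G1} + card ?E * card (pverts G2)"
    using calculation(2,3) finite_undirected_edges[OF assms(1)]
    by (subst card_Un_disjoint) (auto simp: card_image card_cartesian_product)
  moreover have "card ?E = out_degree (with_proj G1) u"
    using card_incident_edges[OF assms(1), of u u] by simp
  ultimately show ?thesis
    by (simp add: out_degree_with_proj)
qed

text \<open>The two ends of \<open>e\<close> add 2 to the degree, which is the source of the shift
  \<open>lam - 2\<close>.\<close>

lemma out_degree_edge_corona_Inr:
  assumes "pair_graph G1" "pair_graph G2" "e \<in> undirected_edges G1" "x \<in> pverts G2"
  shows "out_degree (with_proj (edge_corona G1 G2)) (Inr (e, x)) = out_degree (with_proj G2) x + 2"
proof -
  obtain u v where e: "e = {u, v}" "u \<noteq> v"
    using assms(1,3) by (auto simp: undirected_edges_def pair_graph_iff)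
  have "{w. (Inr (e, x), w) \<in> parcs (edge_corona G1 G2)} =
      Inr ` (Pair e ` {y. (x, y) \<in> parcs G2}) \<union> Inl ` e"
    using assms(3,4) by (auto simp: edge_corona_def)
  moreover have "finite {y. (x, y) \<in> parcs G2}"
    by (rule finite_subset[of _ "pverts G2"]) (use assms(2) in \<open>auto simp: pair_graph_iff\<close>)
  moreover have "card (Inr ` (Pair e ` {y. (x, y) \<in> parcs G2}) \<union> Inl ` e) =
      card {y. (x, y) \<in> parcs G2} + card e"
    using calculation(2) e
    by (subst card_Un_disjoint) (auto simp: card_image inj_on_def)
  moreover have "card e = 2"
    using e by simp
  ultimately show ?thesis
    by (simp add: out_degree_with_proj)
qed

text \<open>The vertex, its neighbours and its non-neighbours partition the vertex set. The additive
  form avoids truncated subtraction.\<close>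

lemma out_degree_graph_complement:
  assumes "pair_graph G" "v \<in> pverts G"
  shows "out_degree (with_proj (graph_complement G)) v + out_degree (with_proj G) v + 1 = card (pverts G)"
proof -
  let ?N = "{w. (v, w) \<in> parcs G}" and ?C = "{w. (v, w) \<in> parcs (graph_complement G)}"
  have fin: "finite (pverts G)"
    using assms(1) by (simp add: pair_graph_iff)
  have sub: "?N \<subseteq> pverts G" "?C \<subseteq> pverts G"
    using assms(1) by (auto simp: pair_graph_iff graph_complement_def)
  have "pverts G = insert v (?C \<union> ?N)"
    using assms by (auto simp: pair_graph_iff graph_complement_def)
  then have "card (pverts G) = card (insert v (?C \<union> ?N))"
    by simp
  also have "\<dots> = Suc (card (?C \<union> ?N))"
    using assms(1) finite_subset[OF sub(1) fin] finite_subset[OF sub(2) fin]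
    by (subst card_insert_disjoint) (auto simp: pair_graph_iff graph_complement_def)
  also have "card (?C \<union> ?N) = card ?C + card ?N"
    using finite_subset[OF sub(1) fin] finite_subset[OF sub(2) fin]
    by (subst card_Un_disjoint) (auto simp: graph_complement_def)
  finally show ?thesis
    by (simp add: out_degree_with_proj)
qed

section \<open>Entries for the complement and the edge corona\<close>

text \<open>On the diagonal the two degrees add up to the number of vertices minus 1; off it exactly
  one of the two graphs has the arc. The sign stands as a factor so that
  \<open>det_indexed_mat_smult\<close> applies.\<close>

lemma signless_entry_graph_complement:
  assumes "pair_graph G" "u \<in> pverts G" "v \<in> pverts G"
  shows "signless_entry (graph_complement G) (of_nat (card (pverts G)) - x) u v =
    - 1 * (signless_entry G (x - 2) u v + 1)"
proof -
  have "of_nat (card (pverts G)) = of_nat (out_degree (with_proj (graph_complement G)) u) +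
      of_nat (out_degree (with_proj G) u) + (1 :: 'b)"
    unfolding out_degree_graph_complement[OF assms(1,2), symmetric] by simp
  moreover have "(u, u) \<notin> parcs G"
    using assms(1) by (auto simp: pair_graph_iff)
  ultimately show ?thesis
    using assms(2,3) by (auto simp: signless_entry_def graph_complement_def)
qed

lemma parcs_edge_corona:
  "(Inl u, Inl v) \<in> parcs (edge_corona G1 G2) \<longleftrightarrow> (u, v) \<in> parcs G1"
  "(Inr (d, x), Inr (e, y)) \<in> parcs (edge_corona G1 G2) \<longleftrightarrow>
    d = e \<and> e \<in> undirected_edges G1 \<and> (x, y) \<in> parcs G2"
  "(Inl u, Inr (e, x)) \<in> parcs (edge_corona G1 G2) \<longleftrightarrow>
    e \<in> undirected_edges G1 \<and> u \<in> e \<and> x \<in> pverts G2"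
  "(Inr (e, x), Inl u) \<in> parcs (edge_corona G1 G2) \<longleftrightarrow>
    e \<in> undirected_edges G1 \<and> u \<in> e \<and> x \<in> pverts G2"
  by (auto simp: edge_corona_def)

text \<open>The term with \<open>card (pverts G2)\<close> is the extra degree of a base vertex, and
  the function of \<open>u\<close> and \<open>e\<close> is the negated incidence matrix.\<close>

lemma signless_entry_edge_corona:
  assumes "pair_graph G1" "pair_graph G2"
    and i: "i \<in> pverts (edge_corona G1 G2)" and j: "j \<in> pverts (edge_corona G1 G2)"
  shows "signless_entry (edge_corona G1 G2) x i j =
    attached_copies
      (\<lambda>u v. signless_entry G1 x u v -
        (if u = v then of_nat (out_degree (with_proj G1) u) * of_nat (card (pverts G2)) else 0))
      (signless_entry G2 (x - 2)) (\<lambda>u e. if u \<in> e then - 1 else 0) i j"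
proof -
  consider (vv) u v where "i = Inl u" "j = Inl v"
    | (vc) u e y where "i = Inl u" "j = Inr (e, y)" "e \<in> undirected_edges G1" "y \<in> pverts G2"
    | (cv) v d z where "i = Inr (d, z)" "j = Inl v" "d \<in> undirected_edges G1" "z \<in> pverts G2"
    | (cc) d z e y where "i = Inr (d, z)" "j = Inr (e, y)" "d \<in> undirected_edges G1"
        "z \<in> pverts G2" "e \<in> undirected_edges G1" "y \<in> pverts G2"
    using i j by (cases i; cases j) (auto simp: edge_corona_def)
  then show ?thesis
  proof cases
    case vv
    then show ?thesis
      by (simp add: signless_entry_def attached_copies_def parcs_edge_corona
          out_degree_edge_corona_Inl[OF assms(1,2)] algebra_simps)
  next
    case cc
    then show ?thesis
      by (simp add: signless_entry_def attached_copies_def parcs_edge_corona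
          out_degree_edge_corona_Inr[OF assms(1,2)] algebra_simps)
  qed (simp_all add: signless_entry_def attached_copies_def parcs_edge_corona)
qed

section \<open>Assembly of the determinant formula\<close>

theorem theorem2p12:
  fixes G1 :: "'a pair_pre_digraph" and G2 :: "'b pair_pre_digraph"
    and vs1 :: "'a list" and vs2 :: "'b list" and vs :: "('a + 'a set \<times> 'b) list"
    and r1 n1 m1 n2 m2 :: nat
    and fQ fQ1 fQ2 fQ2c :: "ratfun \<Rightarrow> ratfun" and lam :: ratfun
  assumes "pair_graph G1" and "Digraph_Component.connected (with_proj G1)" and "regular G1 r1"
    and "n1 = card (pverts G1)" and "m1 = card (undirected_edges G1)"
    and "pair_graph G2" and "Digraph_Component.connected (with_proj G2)"
    and "n2 = card (pverts G2)" and "m2 = card (undirected_edges G2)"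
    and "vertex_enumeration G1 vs1" and "vertex_enumeration G2 vs2"
    and "vertex_enumeration (edge_corona G1 G2) vs"
  defines "fQ \<equiv> signless_char_fun (edge_corona G1 G2) vs"
    and "fQ1 \<equiv> signless_char_fun G1 vs1"
    and "fQ2 \<equiv> signless_char_fun G2 vs2"
    and "fQ2c \<equiv> signless_char_fun (graph_complement G2) vs2"
    and "lam \<equiv> ratfun_var"
  shows "fQ lam =
    fQ2 (lam - 2) ^ m1
    * fQ1 ((-1) ^ n2 * ((lam - of_nat r1 * of_nat n2) * fQ2 (lam - 2) / fQ2c (of_nat n2 - lam)))
    * ((-1) ^ n2 * (fQ2c (of_nat n2 - lam) / fQ2 (lam - 2))) ^ n1"
proof -
  interpret const: comm_ring_hom "\<lambda>c::real. to_fract [:c:]"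
    by (rule comm_ring_hom_const_ratfun)
  have vs1: "distinct vs1" "set vs1 = pverts G1" "length vs1 = n1"
    and vs2: "distinct vs2" "set vs2 = pverts G2" "length vs2 = n2"
    and vs: "distinct vs" "set vs = pverts (edge_corona G1 G2)"
    using assms(4,8,10-12) distinct_card[of vs1] distinct_card[of vs2]
    by (auto simp: vertex_enumeration_def)
  obtain es where es: "distinct es" "set es = undirected_edges G1"
    using finite_distinct_list[OF finite_undirected_edges[OF assms(1)]] by blast
  have len_es: "length es = m1"
    using es assms(5) distinct_card[of es] by simp

  \<comment> \<open>This argument and \<open>of_nat n2 - lam\<close> below are polynomials of degree
    1, so neither evaluation vanishes.\<close>
  have "lam - 2 = to_fract [:-2, 1:]"
    unfolding lam_def ratfun_var_def
    by (simp flip: to_fract_diff const.hom_numeral)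
  then have f2_nz: "fQ2 (lam - 2) \<noteq> 0"
    unfolding fQ2_def by (simp add: signless_char_fun_nonzero)
  have "of_nat n2 - lam = to_fract [:of_nat n2, -1:]"
    unfolding lam_def ratfun_var_def
    by (simp flip: to_fract_diff const.hom_of_nat)
  then have f2c_nz: "fQ2c (of_nat n2 - lam) \<noteq> 0"
    unfolding fQ2c_def by (simp add: signless_char_fun_nonzero)

  let ?M = "signless_entry G2 (lam - 2)"
  have f2: "fQ2 (lam - 2) = det (indexed_mat ?M vs2)"
    unfolding fQ2_def using vs2(1) by (rule signless_char_fun_eq_det)
  \<comment> \<open>\<open>u\<close> is the inverse of \<open>?M\<close> applied to the ones vector,
    so \<open>s\<close> below is one plus the sum of the entries of that inverse.\<close>
  obtain u where u: "\<And>x. x \<in> set vs2 \<Longrightarrow> (\<Sum>y\<in>set vs2. ?M x y * u y) = 1"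
    using indexed_mat_solve[OF vs2(1), of ?M "\<lambda>_. 1"] f2 f2_nz by auto
  define s where "s = 1 + sum u (set vs2)"
  have "fQ2c (of_nat n2 - lam) =
      det (indexed_mat (signless_entry (graph_complement G2) (of_nat n2 - lam)) vs2)"
    unfolding fQ2c_def using vs2(1) by (rule signless_char_fun_eq_det)
  also have "\<dots> = det (indexed_mat (\<lambda>x y. - 1 * (?M x y + 1)) vs2)"
    using signless_entry_graph_complement[OF assms(6)] vs2(2)
    by (auto simp: assms(8) intro!: arg_cong[of _ _ det] indexed_mat_cong)
  \<comment> \<open>The factor \<open>- 1\<close> on each of the \<open>n2\<close> rows gives the
    sign, and the added ones give the factor \<open>s\<close>.\<close>
  also have "\<dots> = (- 1) ^ n2 * (fQ2 (lam - 2) * s)"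
    using det_indexed_mat_add_one[of vs2 ?M u] vs2(1) u
    unfolding det_indexed_mat_smult f2 s_def vs2(3) by simp
  finally have f2c: "fQ2c (of_nat n2 - lam) = (- 1) ^ n2 * (fQ2 (lam - 2) * s)" .
  have s: "(- 1) ^ n2 * (fQ2c (of_nat n2 - lam) / fQ2 (lam - 2)) = s"
    using f2_nz by (simp add: f2c flip: power_mult_distrib)
  have s_nz: "s \<noteq> 0"
    using f2c f2c_nz by auto
  \<comment> \<open>Chosen so that \<open>s * t = lam - of_nat r1 * of_nat n2\<close>: the block
    left after elimination is then \<open>s\<close> times the matrix of
    \<open>signless_entry G1 t\<close>.\<close>
  define t where "t = (lam - of_nat r1 * of_nat n2) / s"
  have t: "(- 1) ^ n2 * ((lam - of_nat r1 * of_nat n2) * fQ2 (lam - 2) / fQ2c (of_nat n2 - lam)) = t"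
    using f2_nz s_nz by (simp add: f2c t_def field_simps flip: power_mult_distrib)

  let ?A = "\<lambda>a b. signless_entry G1 lam a b -
    (if a = b then of_nat (out_degree (with_proj G1) a) * of_nat (card (pverts G2)) else 0)"
  let ?r = "\<lambda>a e. if a \<in> e then - 1 else (0 :: ratfun)"
  let ?ws = "concat (map (\<lambda>e. map (\<lambda>x. Inr (e, x)) vs2) es) @ map Inl vs1"
  have "set vs = set ?ws"
    by (auto simp: vs(2) vs1(2) vs2(2) es(2) edge_corona_def)
  moreover have "?ws = map Inr (List.product es vs2) @ map Inl vs1"
    by (simp add: product_concat_map map_concat comp_def)
  then have "distinct ?ws"
    using es(1) vs1(1) vs2(1) by (simp add: distinct_map distinct_product) auto
  ultimately have reorder: "mset vs = mset ?ws"
    using vs(1) set_eq_iff_mset_eq_distinct by blast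
  have "fQ lam = det (indexed_mat (signless_entry (edge_corona G1 G2) lam) vs)"
    unfolding fQ_def using vs(1) by (rule signless_char_fun_eq_det)
  also have "\<dots> = det (indexed_mat (attached_copies ?A ?M ?r) vs)"
    using signless_entry_edge_corona[OF assms(1,6)] vs(2)
    by (auto intro!: arg_cong[of _ _ det] indexed_mat_cong)
  also have "\<dots> = det (indexed_mat (attached_copies ?A ?M ?r) ?ws)"
    using reorder by (rule det_indexed_mat_reorder)
  also have "\<dots> = det (indexed_mat ?M vs2) ^ length es *
      det (indexed_mat (\<lambda>a b. ?A a b - sum u (set vs2) * (\<Sum>e\<in>set es. ?r a e * ?r b e)) vs1)"
    using vs2(1) u es(1) by (rule det_attached_copies)
  also have "indexed_mat (\<lambda>a b. ?A a b - sum u (set vs2) * (\<Sum>e\<in>set es. ?r a e * ?r b e)) vs1 =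
      indexed_mat (\<lambda>a b. s * signless_entry G1 t a b) vs1"
  proof (rule indexed_mat_cong)
    fix a b assume ab: "a \<in> set vs1" "b \<in> set vs1"
    have deg: "out_degree (with_proj G1) a = r1"
      using ab assms(3) vs1(2) by (auto simp: regular_def)
    have loop: "(b, b) \<notin> parcs G1"
      using assms(1) by (auto simp: pair_graph_iff)
    \<comment> \<open>The two minus signs cancel, so the sum counts the edges containing both
      vertices.\<close>
    have "(\<Sum>e\<in>set es. ?r a e * ?r b e) = (\<Sum>e\<in>set es. if a \<in> e \<and> b \<in> e then 1 else 0)"
      by (rule sum.cong) auto
    also have "\<dots> = of_nat (card {e \<in> set es. a \<in> e \<and> b \<in> e})"
      by (simp add: Int_def flip: sum.inter_filter)
    also have "\<dots> = (if a = b then of_nat r1 else if (a, b) \<in> parcs G1 then 1 else 0)"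
      unfolding es(2) card_incident_edges[OF assms(1)] deg by simp
    finally have inc: "(\<Sum>e\<in>set es. ?r a e * ?r b e) =
      (if a = b then of_nat r1 else if (a, b) \<in> parcs G1 then 1 else 0)" .
    \<comment> \<open>As \<open>sum u (set vs2)\<close> is \<open>s - 1\<close>, the adjacency
      entries get the total factor \<open>- s\<close>, and the diagonal becomes
      \<open>s * t - s * of_nat r1\<close>.\<close>
    show "?A a b - sum u (set vs2) * (\<Sum>e\<in>set es. ?r a e * ?r b e) = s * signless_entry G1 t a b"
    proof (cases "a = b")
      case True
      have "s * t = lam - of_nat r1 * of_nat n2"
        using s_nz by (simp add: t_def)
      then have "s * signless_entry G1 t a b = lam - of_nat r1 * of_nat n2 - s * of_nat r1"
        using True loop deg by (simp add: signless_entry_def right_diff_distrib)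
      then show ?thesis
        unfolding inc using True loop deg
        by (simp add: signless_entry_def s_def assms(8) algebra_simps)
    next
      case False
      then show ?thesis
        unfolding inc by (simp add: signless_entry_def s_def)
    qed
  qed
  also have "det \<dots> = s ^ n1 * fQ1 t"
    unfolding det_indexed_mat_smult fQ1_def signless_char_fun_eq_det[OF vs1(1)] vs1(3) ..
  finally show ?thesis
    unfolding s t by (simp add: f2 len_es mult_ac)
qed

end
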